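(* Let $K$ be an infinite field, $n\le r$ and $p\ge 2$ integers. For $R\in GL_r(K)$ and diagonal matrices $D_1,\ldots,D_p\in M_r(K)$, let $Z_i=R^{-1}D_iR$ and let $A_i$ be the top-left $n\times n$ block of $Z_i$. Then, for a generic choice of $(R,D_1,\ldots,D_p)$, the following hold: (i) if $p\ge 2$ and $r\le 3n/2$, then $\dim\operatorname{Im}[A_k,A_l]=2(r-n)$ for all $k\ne l$; (ii) if $p\ge 3$ and $r\le 4n/3$, then $\dim(\operatorname{Im}[A_k,A_l]+\operatorname{Im}[A_k,A_m])=3(r-n)$ for all pairwise distinct $k,l,m$.
   Context: $[A,B]=AB-BA$, $\operatorname{Im}A$ is the column space. Tuples $(R,D_1,\ldots,D_p)$ are identified with points of $K^N$, $N=r^2+pr$ (entries of $R$ and diagonal entries of the $D_i$). A property holds for a generic choice if there is a nonempty Zariski open subset $O\subseteq K^N$ such that the property holds for every point of $O$ (with $R$ invertible); equivalently, the points failing it lie in the zero set of some polynomial not identically zero. *)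

theory Defs
  imports
    "Jordan_Normal_Form.Matrix"
    "Jordan_Normal_Form.Gauss_Jordan_Elimination"
    "Jordan_Normal_Form.VS_Connect"
    "Jordan_Normal_Form.DL_Rank"
    "HOL-Library.Poly_Mapping"
begin

text \<open>
  Polynomials in the variables \<open>X\<^sub>0, X\<^sub>1, \<dots>\<close>: finitely supported maps from monomials (exponent
  vectors) to coefficients. \<open>mpoly_ring N\<close> consists of those in \<open>X\<^sub>0, \<dots>, X\<^sub>N\<^sub>-\<^sub>1\<close>, so evaluation at a
  point of \<open>K^N\<close> never reads outside the vector.
\<close>

type_synonym 'a mpoly = "(nat \<Rightarrow>\<^sub>0 nat) \<Rightarrow>\<^sub>0 'a"

definition mpoly_ring :: "nat \<Rightarrow> 'a::field mpoly set" where
  "mpoly_ring N = {f. \<forall>m \<in> Poly_Mapping.keys f. Poly_Mapping.keys m \<subseteq> {..<N}}"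

definition mpoly_eval :: "'a::field mpoly \<Rightarrow> 'a vec \<Rightarrow> 'a" where
  "mpoly_eval f x =
     (\<Sum>m \<in> Poly_Mapping.keys f. Poly_Mapping.lookup f m *
        (\<Prod>i \<in> Poly_Mapping.keys m. (x $ i) ^ Poly_Mapping.lookup m i))"

definition zero_locus :: "nat \<Rightarrow> 'a::field mpoly set \<Rightarrow> 'a vec set" where
  "zero_locus N F = {x \<in> carrier_vec N. \<forall>f \<in> F. mpoly_eval f x = 0}"

definition zariski_open :: "nat \<Rightarrow> 'a::field vec set \<Rightarrow> bool" where
  "zariski_open N S \<longleftrightarrow> (\<exists>F \<subseteq> mpoly_ring N. S = carrier_vec N - zero_locus N F)"

definition generic :: "nat \<Rightarrow> ('a::field vec \<Rightarrow> bool) \<Rightarrow> bool" where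
  "generic N P \<longleftrightarrow> (\<exists>S. zariski_open N S \<and> S \<noteq> {} \<and> (\<forall>x \<in> S. P x))"

text \<open>
  A point \<open>x\<close> of \<open>K^(r^2 + p r)\<close> lists the entries of \<open>R\<close> row by row, followed by the
  diagonals of the \<open>p\<close> diagonal matrices, which are indexed from \<open>0\<close> to \<open>p - 1\<close>.
\<close>

definition R_of :: "nat \<Rightarrow> 'a::field vec \<Rightarrow> 'a mat" where
  "R_of r x = mat r r (\<lambda>(i, j). x $ (i * r + j))"

definition D_of :: "nat \<Rightarrow> 'a::field vec \<Rightarrow> nat \<Rightarrow> 'a mat" where
  "D_of r x k = mat_diag r (\<lambda>i. x $ (r ^ 2 + k * r + i))"

text \<open>The value below is meaningful only if \<open>R_of r x\<close> is invertible.\<close>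

definition Z_of :: "nat \<Rightarrow> 'a::field vec \<Rightarrow> nat \<Rightarrow> 'a mat" where
  "Z_of r x k = the (mat_inverse (R_of r x)) * D_of r x k * R_of r x"

definition top_left_block :: "nat \<Rightarrow> 'a mat \<Rightarrow> 'a mat" where
  "top_left_block n Z = mat n n (\<lambda>(i, j). Z $$ (i, j))"

definition A_of :: "nat \<Rightarrow> nat \<Rightarrow> 'a::field vec \<Rightarrow> nat \<Rightarrow> 'a mat" where
  "A_of n r x k = top_left_block n (Z_of r x k)"

definition commutator :: "'a::ring mat \<Rightarrow> 'a mat \<Rightarrow> 'a mat" where
  "commutator A B = A * B - B * A"

text \<open>The following three notions live in the ambient space \<open>K^n\<close>.\<close>

definition Im_mat :: "nat \<Rightarrow> 'a::field mat \<Rightarrow> 'a vec set" where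
  "Im_mat n A = vec_space.col_space n A"

definition subspace_sum :: "nat \<Rightarrow> 'a::field vec set \<Rightarrow> 'a vec set \<Rightarrow> 'a vec set" where
  "subspace_sum n V W = LinearCombinations.module.submodule_sum (module_vec TYPE('a) n) V W"

definition subspace_dim :: "nat \<Rightarrow> 'a::field vec set \<Rightarrow> nat" where
  "subspace_dim n W = vectorspace.dim class_ring (module_vec TYPE('a) n \<lparr>carrier := W\<rparr>)"

end

theory Submission
  imports Defs "HOL-Computational_Algebra.Polynomial" "Jordan_Normal_Form.Determinant"
begin

text \<open>
  Let \<open>s = r - n\<close> and write \<open>Z\<^sub>i = (A\<^sub>i B\<^sub>i; C\<^sub>i E\<^sub>i)\<close>. Since the \<open>Z\<^sub>i\<close> commute,
  \<open>[A\<^sub>k, A\<^sub>l] = B\<^sub>l C\<^sub>k - B\<^sub>k C\<^sub>l\<close>. Hence \<open>Im [A\<^sub>k, A\<^sub>l]\<close> lies in the span of the \<open>2 s\<close> columns of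
  \<open>B\<^sub>k\<close> and \<open>B\<^sub>l\<close>, and the sum of two such images in the span of the \<open>3 s\<close> columns of
  \<open>B\<^sub>k\<close>, \<open>B\<^sub>l\<close> and \<open>B\<^sub>m\<close>. Equality of dimensions holds as soon as
  \<open>det (P ([A\<^sub>k, A\<^sub>l] Q\<^sub>1 + [A\<^sub>k, A\<^sub>m] Q\<^sub>2)) \<noteq> 0\<close> for fixed matrices \<open>P, Q\<^sub>1, Q\<^sub>2\<close>. This is the
  nonvanishing of a polynomial once \<open>R\<^sup>-\<^sup>1\<close> is replaced by the adjugate of \<open>R\<close>, so it suffices to
  exhibit one point where it holds. Over an infinite field, finitely many such conditions can be
  imposed simultaneously.
\<close>

section \<open>Polynomial functions\<close>

definition monom_eval :: "(nat \<Rightarrow>\<^sub>0 nat) \<Rightarrow> 'a::field vec \<Rightarrow> 'a" where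
  "monom_eval m x = (\<Prod>i \<in> Poly_Mapping.keys m. (x $ i) ^ Poly_Mapping.lookup m i)"

text \<open>Coordinates outside the keys have exponent 0 and contribute a factor 1. Enlarging the
  index set lets monomials with different supports be compared over a common one.\<close>

lemma monom_eval_superset:
  assumes "finite S" "Poly_Mapping.keys m \<subseteq> S"
  shows "monom_eval m x = (\<Prod>i \<in> S. (x $ i) ^ Poly_Mapping.lookup m i)"
  unfolding monom_eval_def using assms
  by (intro prod.mono_neutral_left) (auto simp: in_keys_iff)

lemma monom_eval_add: "monom_eval (m + m') x = monom_eval m x * monom_eval m' x"
proof -
  let ?S = "Poly_Mapping.keys m \<union> Poly_Mapping.keys m'"
  have "Poly_Mapping.keys (m + m') \<subseteq> ?S" by (rule Poly_Mapping.keys_add)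
  then show ?thesis
    by (simp add: monom_eval_superset[of ?S] lookup_add power_add prod.distrib)
qed

lemma mpoly_eval_monom_eval:
  "mpoly_eval f x = (\<Sum>m \<in> Poly_Mapping.keys f. Poly_Mapping.lookup f m * monom_eval m x)"
  unfolding mpoly_eval_def monom_eval_def ..

lemma mpoly_eval_add: "mpoly_eval (f + g) x = mpoly_eval f x + mpoly_eval g x"
  unfolding mpoly_eval_monom_eval
  by (rule setsum_keys_plus_distrib[where f = "\<lambda>m c. c * monom_eval m x"])
     (auto simp: distrib_right)

lemma mpoly_eval_zero [simp]: "mpoly_eval 0 x = 0"
  by (simp add: mpoly_eval_def)

lemma mpoly_eval_single: "mpoly_eval (Poly_Mapping.single m c) x = c * monom_eval m x"
  by (simp add: mpoly_eval_monom_eval)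

lemma mpoly_eval_sum: "mpoly_eval (sum f A) x = (\<Sum>a\<in>A. mpoly_eval (f a) x)"
  by (induction A rule: infinite_finite_induct) (auto simp: mpoly_eval_add)

lemma poly_mapping_eq_sum_single:
  "f = (\<Sum>m \<in> Poly_Mapping.keys f. Poly_Mapping.single m (Poly_Mapping.lookup f m))"
  by (rule poly_mapping_eqI) (auto simp: lookup_sum lookup_single when_def in_keys_iff)

text \<open>Both factors are expanded into single terms, for which multiplicativity is that of
  monomials under addition of exponents.\<close>

lemma mpoly_eval_mult: "mpoly_eval (f * g) x = mpoly_eval f x * mpoly_eval g x"
proof -
  have "f * g = (\<Sum>m \<in> Poly_Mapping.keys f. \<Sum>m' \<in> Poly_Mapping.keys g.
      Poly_Mapping.single (m + m') (Poly_Mapping.lookup f m * Poly_Mapping.lookup g m'))"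
    by (subst poly_mapping_eq_sum_single[of f], subst poly_mapping_eq_sum_single[of g])
       (simp add: sum_product mult_single)
  then show ?thesis
    by (simp add: mpoly_eval_sum mpoly_eval_single monom_eval_add mpoly_eval_monom_eval[of f]
        mpoly_eval_monom_eval[of g] sum_product mult_ac)
qed

text \<open>Restricting to a line reduces products of nonzero polynomial functions to one variable.\<close>

lemma mpoly_eval_on_line:
  assumes "f \<in> mpoly_ring N" "x \<in> carrier_vec N" "y \<in> carrier_vec N"
  obtains q where "\<And>t. poly q t = mpoly_eval f (x + t \<cdot>\<^sub>v (y - x))"
proof
  fix t
  let ?q = "\<Sum>m \<in> Poly_Mapping.keys f. [:Poly_Mapping.lookup f m:] *
        (\<Prod>i \<in> Poly_Mapping.keys m. [:x $ i, y $ i - x $ i:] ^ Poly_Mapping.lookup m i)"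
  have "i < N" if "m \<in> Poly_Mapping.keys f" "i \<in> Poly_Mapping.keys m" for m i
    using assms(1) that by (auto simp: mpoly_ring_def)
  then show "poly ?q t = mpoly_eval f (x + t \<cdot>\<^sub>v (y - x))"
    using assms(2,3) by (auto simp: mpoly_eval_def poly_sum poly_prod poly_power intro!: sum.cong prod.cong)
qed

section \<open>Closure of polynomial functions under ring operations, determinants and
  adjugates\<close>

definition polyfun :: "nat \<Rightarrow> ('a::field vec \<Rightarrow> 'a) \<Rightarrow> bool" where
  "polyfun N f \<longleftrightarrow> (\<exists>g \<in> mpoly_ring N. \<forall>x \<in> carrier_vec N. f x = mpoly_eval g x)"

lemma polyfun_cong:
  assumes "polyfun N g" "\<And>x. x \<in> carrier_vec N \<Longrightarrow> f x = g x"
  shows "polyfun N f"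
  using assms unfolding polyfun_def by auto

lemma polyfun_const: "polyfun N (\<lambda>x. c)"
  unfolding polyfun_def
  by (rule bexI[of _ "Poly_Mapping.single 0 c"])
     (auto simp: mpoly_eval_single monom_eval_def mpoly_ring_def)

lemma polyfun_coord:
  assumes "i < N"
  shows "polyfun N (\<lambda>x. x $ i)"
  unfolding polyfun_def using assms
  by (intro bexI[of _ "Poly_Mapping.single (Poly_Mapping.single i 1) 1"])
     (auto simp: mpoly_eval_single monom_eval_def mpoly_ring_def)

lemma polyfun_add:
  assumes "polyfun N f" "polyfun N g"
  shows "polyfun N (\<lambda>x. f x + g x)"
proof -
  obtain a b where "a \<in> mpoly_ring N" "b \<in> mpoly_ring N"
    and "\<forall>x \<in> carrier_vec N. f x = mpoly_eval a x" "\<forall>x \<in> carrier_vec N. g x = mpoly_eval b x"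
    using assms unfolding polyfun_def by blast
  moreover have "a + b \<in> mpoly_ring N"
    using calculation(1,2) Poly_Mapping.keys_add[of a b] by (fastforce simp: mpoly_ring_def)
  ultimately show ?thesis
    unfolding polyfun_def by (intro bexI[of _ "a + b"]) (auto simp: mpoly_eval_add)
qed

lemma polyfun_mult:
  assumes "polyfun N f" "polyfun N g"
  shows "polyfun N (\<lambda>x. f x * g x)"
proof -
  obtain a b where ab: "a \<in> mpoly_ring N" "b \<in> mpoly_ring N"
    and "\<forall>x \<in> carrier_vec N. f x = mpoly_eval a x" "\<forall>x \<in> carrier_vec N. g x = mpoly_eval b x"
    using assms unfolding polyfun_def by blast
  moreover have "a * b \<in> mpoly_ring N"
    unfolding mpoly_ring_def
  proof (safe)
    fix m i
    assume "m \<in> Poly_Mapping.keys (a * b)" and i: "i \<in> Poly_Mapping.keys m"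
    then obtain u v where "m = u + v" "u \<in> Poly_Mapping.keys a" "v \<in> Poly_Mapping.keys b"
      using keys_mult[of a b] by blast
    then show "i < N"
      using ab i Poly_Mapping.keys_add[of u v] unfolding mpoly_ring_def by blast
  qed
  ultimately show ?thesis
    unfolding polyfun_def by (intro bexI[of _ "a * b"]) (auto simp: mpoly_eval_mult)
qed

lemma polyfun_diff:
  assumes "polyfun N f" "polyfun N g"
  shows "polyfun N (\<lambda>x. f x - g x)"
  using polyfun_add[OF assms(1) polyfun_mult[OF polyfun_const[of N "- 1"] assms(2)]] by simp

lemma polyfun_sum:
  assumes "\<And>a. a \<in> A \<Longrightarrow> polyfun N (f a)"
  shows "polyfun N (\<lambda>x. \<Sum>a\<in>A. f a x)"
  using assms by (induction A rule: infinite_finite_induct) (auto intro: polyfun_const polyfun_add)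

lemma polyfun_prod:
  assumes "\<And>a. a \<in> A \<Longrightarrow> polyfun N (f a)"
  shows "polyfun N (\<lambda>x. \<Prod>a\<in>A. f a x)"
  using assms by (induction A rule: infinite_finite_induct) (auto intro: polyfun_const polyfun_mult)

text \<open>The dimensions are required at every vector, even outside K^N, so that entry and
  determinant formulas apply without conditions on the point.\<close>

definition polyfun_mat :: "nat \<Rightarrow> nat \<Rightarrow> nat \<Rightarrow> ('a::field vec \<Rightarrow> 'a mat) \<Rightarrow> bool" where
  "polyfun_mat N nr nc M \<longleftrightarrow> (\<forall>x. M x \<in> carrier_mat nr nc) \<and>
     (\<forall>i < nr. \<forall>j < nc. polyfun N (\<lambda>x. M x $$ (i, j)))"

lemma polyfun_mat_const: "C \<in> carrier_mat nr nc \<Longrightarrow> polyfun_mat N nr nc (\<lambda>x. C)"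
  by (simp add: polyfun_mat_def polyfun_const)

lemma polyfun_mat_mat:
  assumes "\<And>i j. i < nr \<Longrightarrow> j < nc \<Longrightarrow> polyfun N (\<lambda>x. f x (i, j))"
  shows "polyfun_mat N nr nc (\<lambda>x. mat nr nc (f x))"
  using assms by (simp add: polyfun_mat_def)

lemma polyfun_mat_mult:
  assumes "polyfun_mat N a b L" "polyfun_mat N b c M"
  shows "polyfun_mat N a c (\<lambda>x. L x * M x)"
proof -
  have carr: "L x \<in> carrier_mat a b" "M x \<in> carrier_mat b c" for x
    using assms by (auto simp: polyfun_mat_def)
  have "polyfun N (\<lambda>x. (L x * M x) $$ (i, j))" if "i < a" "j < c" for i j
  proof (rule polyfun_cong)
    show "polyfun N (\<lambda>x. \<Sum>t = 0..<b. L x $$ (i, t) * M x $$ (t, j))"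
      using assms that by (intro polyfun_sum polyfun_mult) (auto simp: polyfun_mat_def)
    show "(L x * M x) $$ (i, j) = (\<Sum>t = 0..<b. L x $$ (i, t) * M x $$ (t, j))" for x
      using carr[of x] that by (simp add: scalar_prod_def)
  qed
  then show ?thesis
    using mult_carrier_mat[OF carr] by (simp add: polyfun_mat_def)
qed

lemma polyfun_mat_add:
  assumes "polyfun_mat N a b L" "polyfun_mat N a b M"
  shows "polyfun_mat N a b (\<lambda>x. L x + M x)"
proof -
  have carr: "L x \<in> carrier_mat a b" "M x \<in> carrier_mat a b" for x
    using assms by (auto simp: polyfun_mat_def)
  have "polyfun N (\<lambda>x. (L x + M x) $$ (i, j))" if "i < a" "j < b" for i j
  proof (rule polyfun_cong)
    show "polyfun N (\<lambda>x. L x $$ (i, j) + M x $$ (i, j))"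
      using assms that by (intro polyfun_add) (auto simp: polyfun_mat_def)
    show "(L x + M x) $$ (i, j) = L x $$ (i, j) + M x $$ (i, j)" for x
      using carrier_matD[OF carr(1)[of x]] carrier_matD[OF carr(2)[of x]] that by simp
  qed
  then show ?thesis using add_carrier_mat[OF carr(2)] by (simp add: polyfun_mat_def)
qed

lemma polyfun_mat_minus:
  assumes "polyfun_mat N a b L" "polyfun_mat N a b M"
  shows "polyfun_mat N a b (\<lambda>x. L x - M x)"
proof -
  have carr: "L x \<in> carrier_mat a b" "M x \<in> carrier_mat a b" for x
    using assms by (auto simp: polyfun_mat_def)
  have "polyfun N (\<lambda>x. (L x - M x) $$ (i, j))" if "i < a" "j < b" for i j
  proof (rule polyfun_cong)
    show "polyfun N (\<lambda>x. L x $$ (i, j) - M x $$ (i, j))"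
      using assms that by (intro polyfun_diff) (auto simp: polyfun_mat_def)
    show "(L x - M x) $$ (i, j) = L x $$ (i, j) - M x $$ (i, j)" for x
      using carrier_matD[OF carr(1)[of x]] carrier_matD[OF carr(2)[of x]] that by simp
  qed
  then show ?thesis using minus_carrier_mat[OF carr(2)] by (simp add: polyfun_mat_def)
qed

lemma polyfun_det:
  assumes "polyfun_mat N a a M"
  shows "polyfun N (\<lambda>x. det (M x))"
proof (rule polyfun_cong)
  show "polyfun N (\<lambda>x. \<Sum>p \<in> {p. p permutes {0..<a}}. signof p * (\<Prod>i = 0..<a. M x $$ (i, p i)))"
  proof (intro polyfun_sum polyfun_mult polyfun_const polyfun_prod)
    fix p i assume "p \<in> {p. p permutes {0..<a}}" "i \<in> {0..<a}"
    then have "p i < a" using permutes_in_image[of p "{0..<a}" i] by auto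
    then show "polyfun N (\<lambda>x. M x $$ (i, p i))"
      using assms \<open>i \<in> _\<close> by (auto simp: polyfun_mat_def)
  qed
  show "det (M x) = (\<Sum>p \<in> {p. p permutes {0..<a}}. signof p * (\<Prod>i = 0..<a. M x $$ (i, p i)))" for x
    using assms by (intro det_def') (auto simp: polyfun_mat_def)
qed

text \<open>Each entry of the adjugate is, up to sign, the determinant of a submatrix.\<close>

lemma polyfun_mat_adj:
  assumes "polyfun_mat N a a M"
  shows "polyfun_mat N a a (\<lambda>x. adj_mat (M x))"
proof -
  have carr: "M x \<in> carrier_mat a a" for x using assms by (auto simp: polyfun_mat_def)
  have del: "polyfun_mat N (a - 1) (a - 1) (\<lambda>x. mat_delete (M x) i j)" if "i < a" "j < a" for i j
    unfolding mat_delete_def carrier_matD[OF carr] using assms that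
    by (intro polyfun_mat_mat) (auto simp: polyfun_mat_def)
  show ?thesis
    unfolding adj_mat_def carrier_matD[OF carr] cofactor_def
    by (intro polyfun_mat_mat) (auto intro!: polyfun_mult polyfun_const polyfun_det del)
qed

section \<open>Principal open sets and their finite intersections\<close>

definition basic_generic :: "nat \<Rightarrow> ('a::field vec \<Rightarrow> bool) \<Rightarrow> bool" where
  "basic_generic N P \<longleftrightarrow> (\<exists>f. polyfun N f \<and> (\<exists>x \<in> carrier_vec N. f x \<noteq> 0) \<and>
     (\<forall>x \<in> carrier_vec N. f x \<noteq> 0 \<longrightarrow> P x))"

lemma generic_if_basic_generic:
  assumes "basic_generic N P"
  shows "generic N P"
proof -
  obtain g where g: "g \<in> mpoly_ring N" "\<exists>x \<in> carrier_vec N. mpoly_eval g x \<noteq> 0"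
    "\<forall>x \<in> carrier_vec N. mpoly_eval g x \<noteq> 0 \<longrightarrow> P x"
    using assms unfolding basic_generic_def polyfun_def by (metis (no_types, lifting))
  then show ?thesis
    unfolding generic_def zariski_open_def
    by (intro exI[of _ "carrier_vec N - zero_locus N {g}"]) (auto simp: zero_locus_def)
qed

text \<open>The conjunction is witnessed by the product of the two polynomial functions; the point
  is that this product is not identically zero. On the line joining a point where \<open>f\<close>
  is nonzero to one where \<open>g\<close> is nonzero, both become nonzero polynomials in one
  variable, and their product has only finitely many roots in an infinite field.\<close>

lemma basic_generic_conj:
  fixes P Q :: "'a::field vec \<Rightarrow> bool"
  assumes inf: "infinite (UNIV :: 'a set)" and "basic_generic N P" "basic_generic N Q"
  shows "basic_generic N (\<lambda>x. P x \<and> Q x)"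
proof -
  obtain f x where f: "polyfun N f" "x \<in> carrier_vec N" "f x \<noteq> 0"
    "\<forall>x \<in> carrier_vec N. f x \<noteq> 0 \<longrightarrow> P x"
    using assms(2) unfolding basic_generic_def by blast
  obtain g y where g: "polyfun N g" "y \<in> carrier_vec N" "g y \<noteq> 0"
    "\<forall>x \<in> carrier_vec N. g x \<noteq> 0 \<longrightarrow> Q x"
    using assms(3) unfolding basic_generic_def by blast
  define z where "z t = x + t \<cdot>\<^sub>v (y - x)" for t
  have z: "z t \<in> carrier_vec N" "z 0 = x" "z 1 = y" for t
    using f(2) g(2) by (auto simp: z_def)
  have line: "\<exists>q. \<forall>t. poly q t = h (z t)" if h: "polyfun N h" for h
  proof -
    obtain a where a: "a \<in> mpoly_ring N" "\<forall>x \<in> carrier_vec N. h x = mpoly_eval a x"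
      using h unfolding polyfun_def by blast
    obtain q where "\<And>t. poly q t = mpoly_eval a (z t)"
      using mpoly_eval_on_line[OF a(1) f(2) g(2)] unfolding z_def by blast
    then show ?thesis using a(2) z(1) by auto
  qed
  obtain u v where u: "\<And>t. poly u t = f (z t)" and v: "\<And>t. poly v t = g (z t)"
    using line[OF f(1)] line[OF g(1)] by blast
  \<comment> \<open>The parameter 0 gives \<open>x\<close>, where \<open>u\<close> is nonzero, and 1
    gives \<open>y\<close>, where \<open>v\<close> is nonzero.\<close>
  have "u * v \<noteq> 0"
    using u[of 0] v[of 1] f(3) g(3) z by auto
  then have "finite {t. poly (u * v) t = 0}" by (rule poly_roots_finite)
  then obtain t where "poly (u * v) t \<noteq> 0"
    using inf by (metis (mono_tags, lifting) UNIV_eq_I mem_Collect_eq)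
  then have "f (z t) * g (z t) \<noteq> 0" by (simp add: u v)
  then show ?thesis
    unfolding basic_generic_def using f g z(1) 
    by (intro exI[of _ "\<lambda>x. f x * g x"]) (auto intro: polyfun_mult)
qed

lemma basic_generic_ball:
  fixes P :: "'b \<Rightarrow> 'a::field vec \<Rightarrow> bool"
  assumes "infinite (UNIV :: 'a set)" and "finite T" "\<And>t. t \<in> T \<Longrightarrow> basic_generic N (P t)"
  shows "basic_generic N (\<lambda>x. \<forall>t \<in> T. P t x)"
  using assms(2,3)
proof (induction T rule: finite_induct)
  case empty
  have "basic_generic N (\<lambda>x. True)"
    unfolding basic_generic_def
    by (intro exI[of _ "\<lambda>x. 1"]) (auto intro!: polyfun_const exI[of _ "0\<^sub>v N"])
  then show ?case by simp
next
  case (insert t T)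
  then show ?case using basic_generic_conj[OF assms(1), of N "P t"] by simp
qed

section \<open>Ranges of commutators of blocks\<close>

lemma mult_unit_vec_eq_col:
  fixes A :: "'a::semiring_1 mat"
  assumes "A \<in> carrier_mat n c" "j < c"
  shows "A *\<^sub>v unit_vec c j = col A j"
  using assms by (intro eq_vecI) (auto simp: scalar_prod_right_unit)

lemma inverse_if_det_nonzero:
  fixes A :: "'a::field mat"
  assumes "A \<in> carrier_mat n n" "det A \<noteq> 0"
  obtains B where "B \<in> carrier_mat n n" "A * B = 1\<^sub>m n" "B * A = 1\<^sub>m n"
  using det_non_zero_imp_unit[OF assms, of "()"] by (auto simp: Units_def ring_mat_def)

text \<open>If \<open>B\<close> kills a vector, so does the invertible matrix \<open>L * B\<close>;
  hence the columns of \<open>B\<close> satisfy no nontrivial relation.\<close>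

lemma rank_eq_if_left_invertible:
  fixes B :: "'a::field mat"
  assumes B: "B \<in> carrier_mat n c" and L: "L \<in> carrier_mat c n" and det: "det (L * B) \<noteq> 0"
  shows "vec_space.rank n B = c"
proof -
  interpret vec_space "TYPE('a)" n .
  have LB: "L * B \<in> carrier_mat c c" using L B by simp
  have inj: "v = 0\<^sub>v c" if "v \<in> carrier_vec c" "B *\<^sub>v v = 0\<^sub>v n" for v
  proof -
    have "(L * B) *\<^sub>v v = 0\<^sub>v c"
      using that L by (intro eq_vecI) (auto simp: assoc_mult_mat_vec[OF L B])
    then show ?thesis using det_0_iff_vec_prod_zero_field[OF LB] det that by blast
  qed
  \<comment> \<open>Independence refers to the set of columns, so repeated columns are excluded
    separately: two equal ones would put a difference of unit vectors into the kernel.\<close>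
  have "distinct (cols B)"
    unfolding distinct_conv_nth
  proof (intro allI impI)
    fix i j assume "i < length (cols B)" "j < length (cols B)" and ij: "i \<noteq> j"
    then have lt: "i < c" "j < c" using B by auto
    show "cols B ! i \<noteq> cols B ! j"
    proof
      assume "cols B ! i = cols B ! j"
      then have "B *\<^sub>v (unit_vec c i - unit_vec c j) = 0\<^sub>v n"
        using lt B by (simp add: mult_minus_distrib_mat_vec[OF B] mult_unit_vec_eq_col[OF B])
      then have "unit_vec c i - unit_vec c j = (0\<^sub>v c :: 'a vec)" by (intro inj) auto
      then have "(unit_vec c i - unit_vec c j) $ i = (0 :: 'a)" using lt by simp
      then show False using lt ij by simp
    qed
  qed
  moreover have "lin_indpt (set (cols B))"
    using lin_depE[OF B _ \<open>distinct (cols B)\<close>] inj by blast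
  ultimately show ?thesis by (rule lin_indpt_full_rank[OF B])
qed

text \<open>The vectors \<open>ws\<close>, as columns of \<open>B\<close>, bound the dimension from
  above, and the columns of \<open>S\<close> from below. Writing \<open>S = B * T\<close> with
  \<open>T\<close> square, \<open>det (P * S)\<close> factors as \<open>det (P * B) * det T\<close>.
  So \<open>T\<close> is invertible, \<open>W\<close> is the whole column space of \<open>B\<close>,
  and \<open>B\<close> has rank \<open>c\<close>.\<close>

lemma subspace_dim_eqI:
  fixes W :: "'a::field vec set"
  assumes ws: "set ws \<subseteq> carrier_vec n" "length ws = c"
    and upper: "W \<subseteq> LinearCombinations.module.span class_ring (module_vec TYPE('a) n) (set ws)"
    and S: "S \<in> carrier_mat n c" and lower: "\<And>v. v \<in> carrier_vec c \<Longrightarrow> S *\<^sub>v v \<in> W"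
    and P: "P \<in> carrier_mat c n" and det: "det (P * S) \<noteq> 0"
  shows "subspace_dim n W = c"
proof -
  interpret vec_space "TYPE('a)" n .
  define B where "B = mat_of_cols n ws"
  have B: "B \<in> carrier_mat n c" using ws by (auto simp: B_def)
  have cols: "cols B = ws" using ws by (auto simp: B_def)
  have span: "span (set ws) = {B *\<^sub>v x | x. x \<in> carrier_vec c}"
    using col_space_eq[OF B] B unfolding col_space_def cols by auto
  have "\<exists>t. t \<in> carrier_vec c \<and> B *\<^sub>v t = col S j" if "j < c" for j
  proof -
    have "col S j \<in> {B *\<^sub>v x | x. x \<in> carrier_vec c}"
      using lower[of "unit_vec c j"] upper that by (auto simp: span mult_unit_vec_eq_col[OF S])
    then show ?thesis by (auto simp: eq_commute)
  qed
  then obtain t where t: "\<And>j. j < c \<Longrightarrow> t j \<in> carrier_vec c" "\<And>j. j < c \<Longrightarrow> B *\<^sub>v t j = col S j"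
    by metis
  define T where "T = mat_of_cols c (map t [0..<c])"
  have T: "T \<in> carrier_mat c c"
    using mat_of_cols_carrier(1)[of c "map t [0..<c]"] by (simp add: T_def)
  have colT: "col T j = t j" if "j < c" for j
    using that t(1) by (simp add: T_def)
  have ST: "S = B * T"
  proof (rule mat_col_eqI)
    fix j assume "j < dim_col (B * T)"
    then have j: "j < c" using T by simp
    then show "col S j = col (B * T) j"
      using t(2)[OF j] by (simp add: col_mult2[OF B T j] colT)
  qed (use S B T in auto)
  have "det ((P * B) * T) \<noteq> 0"
    using det by (simp add: ST assoc_mult_mat[OF P B T])
  then have det2: "det (P * B) \<noteq> 0" "det T \<noteq> 0"
    using P B by (auto simp: det_mult[OF _ T, of "P * B"])
  obtain T' where T': "T' \<in> carrier_mat c c" "T * T' = 1\<^sub>m c"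
    using inverse_if_det_nonzero[OF T det2(2)] by metis
  \<comment> \<open>Since \<open>B = S * T'\<close>, every value of \<open>B\<close> is a value of
    \<open>S\<close>.\<close>
  have "B *\<^sub>v x \<in> W" if x: "x \<in> carrier_vec c" for x
  proof -
    have "S *\<^sub>v (T' *\<^sub>v x) = B *\<^sub>v ((T * T') *\<^sub>v x)"
      using x T'(1) T B by (simp add: ST assoc_mult_mat_vec[OF B T] assoc_mult_mat_vec[OF T T'(1)])
    also have "\<dots> = B *\<^sub>v x" using x T'(2) by simp
    finally show ?thesis using lower[of "T' *\<^sub>v x"] T'(1) x by simp
  qed
  then have "W = span (set (cols B))" using upper by (auto simp: span cols)
  then have "subspace_dim n W = rank B"
    by (simp add: subspace_dim_def rank_def)
  also have "\<dots> = c" by (rule rank_eq_if_left_invertible[OF B P det2(1)])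
  finally show ?thesis .
qed

section \<open>Block decomposition of commuting matrices\<close>

definition top_right_block :: "nat \<Rightarrow> nat \<Rightarrow> 'a mat \<Rightarrow> 'a mat" where
  "top_right_block n s Z = mat n s (\<lambda>(i, j). Z $$ (i, n + j))"

definition bottom_left_block :: "nat \<Rightarrow> nat \<Rightarrow> 'a mat \<Rightarrow> 'a mat" where
  "bottom_left_block n s Z = mat s n (\<lambda>(i, j). Z $$ (n + i, j))"

lemma top_left_block_carrier [simp]: "top_left_block n Z \<in> carrier_mat n n"
  and top_right_block_carrier [simp]: "top_right_block n s Z \<in> carrier_mat n s"
  and bottom_left_block_carrier [simp]: "bottom_left_block n s Z \<in> carrier_mat s n"
  by (simp_all add: top_left_block_def top_right_block_def bottom_left_block_def)

lemma top_left_block_mult: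
  fixes Y Z :: "'a::ring mat"
  assumes Y: "Y \<in> carrier_mat (n + s) (n + s)" and Z: "Z \<in> carrier_mat (n + s) (n + s)"
  shows "top_left_block n (Y * Z) = top_left_block n Y * top_left_block n Z
    + top_right_block n s Y * bottom_left_block n s Z"
proof (rule eq_matI)
  fix i j
  assume "i < dim_row (top_left_block n Y * top_left_block n Z
    + top_right_block n s Y * bottom_left_block n s Z)"
    and "j < dim_col (top_left_block n Y * top_left_block n Z
    + top_right_block n s Y * bottom_left_block n s Z)"
  then have ij: "i < n" "j < n" by (auto simp: bottom_left_block_def top_right_block_def)
  have "(\<Sum>t = 0..<n + s. Y $$ (i, t) * Z $$ (t, j)) =
      (\<Sum>t = 0..<n. Y $$ (i, t) * Z $$ (t, j)) + (\<Sum>t = 0..<s. Y $$ (i, n + t) * Z $$ (n + t, j))"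
    using sum.atLeastLessThan_concat[of 0 n "n + s" "\<lambda>t. Y $$ (i, t) * Z $$ (t, j)"]
      sum.shift_bounds_nat_ivl[of "\<lambda>t. Y $$ (i, t) * Z $$ (t, j)" 0 n s]
    by (simp add: add.commute)
  then show "top_left_block n (Y * Z) $$ (i, j) = (top_left_block n Y * top_left_block n Z
    + top_right_block n s Y * bottom_left_block n s Z) $$ (i, j)"
    using ij Y Z
    by (simp add: top_left_block_def top_right_block_def bottom_left_block_def scalar_prod_def)
qed (auto simp: top_left_block_def bottom_left_block_def top_right_block_def)

text \<open>Comparing the top left blocks of \<open>Y * Z\<close> and \<open>Z * Y\<close> gives A
  A' + B C' = A' A + B' C, where A, B, C and A', B', C' are the top left, top right and bottom left
  blocks of \<open>Y\<close> and of \<open>Z\<close>.\<close>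

lemma commutator_top_left_block:
  fixes Y Z :: "'a::ring mat"
  assumes Y: "Y \<in> carrier_mat (n + s) (n + s)" and Z: "Z \<in> carrier_mat (n + s) (n + s)"
    and comm: "Y * Z = Z * Y"
  shows "commutator (top_left_block n Y) (top_left_block n Z) =
    top_right_block n s Z * bottom_left_block n s Y - top_right_block n s Y * bottom_left_block n s Z"
proof -
  have *: "A - B = D - C" if "A + C = B + D" "A \<in> carrier_mat n n" "B \<in> carrier_mat n n"
    "C \<in> carrier_mat n n" "D \<in> carrier_mat n n" for A B C D :: "'a mat"
  proof (rule eq_matI)
    fix i j assume "i < dim_row (D - C)" "j < dim_col (D - C)"
    then have ij: "i < n" "j < n" using that by auto
    have "(A + C) $$ (i, j) = (B + D) $$ (i, j)" using that(1) by simp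
    then show "(A - B) $$ (i, j) = (D - C) $$ (i, j)"
      using that(2-) ij by (simp add: algebra_simps)
  qed (use that in auto)
  show ?thesis
    unfolding commutator_def
    using top_left_block_mult[OF Y Z] top_left_block_mult[OF Z Y] comm
    by (intro *) (auto intro: mult_carrier_mat[of _ _ s] mult_carrier_mat[of _ _ n])
qed

lemma commutator_range_subset_span:
  fixes Y Z :: "'a::field mat"
  assumes YZ: "Y \<in> carrier_mat (n + s) (n + s)" "Z \<in> carrier_mat (n + s) (n + s)" "Y * Z = Z * Y"
    and v: "v \<in> carrier_vec n"
  shows "commutator (top_left_block n Y) (top_left_block n Z) *\<^sub>v v \<in>
    LinearCombinations.module.span class_ring (module_vec TYPE('a) n)
      (set (cols (top_right_block n s Y) @ cols (top_right_block n s Z)))"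
proof -
  interpret vec_space "TYPE('a)" n .
  let ?ws = "cols (top_right_block n s Y) @ cols (top_right_block n s Z)"
  have ws: "set ?ws \<subseteq> carrier_vec n"
    using cols_dim[of "top_right_block n s Y"] cols_dim[of "top_right_block n s Z"]
    by (auto simp: top_right_block_def)
  have mem: "M *\<^sub>v w \<in> span (set ?ws)"
    if "M \<in> carrier_mat n s" "set (cols M) \<subseteq> set ?ws" "w \<in> carrier_vec s" for M w
  proof -
    have "M *\<^sub>v w \<in> span (set (cols M))"
      using col_space_eq[OF that(1)] that(1,3) unfolding col_space_def by auto
    then show ?thesis using span_is_monotone[OF that(2)] by blast
  qed
  define y where "y = bottom_left_block n s Y *\<^sub>v v"
  \<comment> \<open>The minus sign of the commutator formula is moved into \<open>z\<close>, so that
    the image of \<open>v\<close> is a sum of two elements of the span.\<close>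
  define z where "z = (-1) \<cdot>\<^sub>v (bottom_left_block n s Z *\<^sub>v v)"
  have yz: "y \<in> carrier_vec s" "z \<in> carrier_vec s"
    using v by (auto simp: y_def z_def intro: mult_mat_vec_carrier[of _ s n])
  have prod: "top_right_block n s M * bottom_left_block n s M' \<in> carrier_mat n n" for M M' :: "'a mat"
    by (rule mult_carrier_mat[of _ _ s]) auto
  have "top_right_block n s Y *\<^sub>v z =
      (-1) \<cdot>\<^sub>v (top_right_block n s Y *\<^sub>v (bottom_left_block n s Z *\<^sub>v v))"
    using v unfolding z_def
    by (intro mult_mat_vec[of _ n s]) (auto intro: mult_mat_vec_carrier[of _ s n])
  then have "commutator (top_left_block n Y) (top_left_block n Z) *\<^sub>v v =
      top_right_block n s Z *\<^sub>v y + top_right_block n s Y *\<^sub>v z"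
    using v unfolding commutator_top_left_block[OF YZ] y_def
    by (auto simp: minus_mult_distrib_mat_vec[OF prod prod v] assoc_mult_mat_vec[of _ n s _ n])
  also have "\<dots> \<in> span (set ?ws)"
    using yz ws by (intro span_add1 mem) auto
  finally show ?thesis .
qed

section \<open>Nonvanishing of a determinant as a generic condition\<close>

lemma mult_carrier_mat_square [simp]:
  "A \<in> carrier_mat n n \<Longrightarrow> B \<in> carrier_mat n c \<Longrightarrow> A * B \<in> carrier_mat n c"
  by (rule mult_carrier_mat)

section \<open>The conjugated diagonal matrices and their blocks\<close>

lemma R_of_carrier [simp]: "R_of r x \<in> carrier_mat r r"
  and D_of_carrier [simp]: "D_of r x k \<in> carrier_mat r r"
  by (simp_all add: R_of_def D_of_def)

lemma A_of_carrier [simp]: "A_of n r x k \<in> carrier_mat n n"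
  by (simp add: A_of_def)

lemma commutator_carrier [simp]:
  "A \<in> carrier_mat n n \<Longrightarrow> B \<in> carrier_mat n n \<Longrightarrow> commutator A B \<in> carrier_mat n n"
  unfolding commutator_def by (intro minus_carrier_mat mult_carrier_mat)

lemma mat_inverse_eqI:
  fixes A :: "'a::field mat"
  assumes A: "A \<in> carrier_mat n n" and B: "B \<in> carrier_mat n n"
    and AB: "A * B = 1\<^sub>m n" and BA: "B * A = 1\<^sub>m n"
  shows "mat_inverse A = Some B"
proof (cases "mat_inverse A")
  case None
  have "A \<in> Units (ring_mat TYPE('a) n ())"
    using assms by (auto simp: Units_def ring_mat_def)
  then show ?thesis using mat_inverse(1)[OF A None, of "()"] by blast
next
  case (Some C)
  then have C: "C \<in> carrier_mat n n" "C * A = 1\<^sub>m n" using mat_inverse(2)[OF A Some] by auto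
  have "C = C * (A * B)" using AB C by simp
  also have "\<dots> = (C * A) * B" by (rule assoc_mult_mat[OF C(1) A B, symmetric])
  also have "\<dots> = B" using B C by simp
  finally show ?thesis using Some by simp
qed

lemma Z_of_eq:
  assumes "B \<in> carrier_mat r r" "R_of r x * B = 1\<^sub>m r" "B * R_of r x = 1\<^sub>m r"
  shows "Z_of r x k = B * D_of r x k * R_of r x"
  using mat_inverse_eqI[OF R_of_carrier assms] by (simp add: Z_of_def)

lemma Z_of_carrier:
  assumes "det (R_of r x) \<noteq> 0"
  shows "Z_of r x k \<in> carrier_mat r r"
proof -
  obtain B where B: "B \<in> carrier_mat r r" "R_of r x * B = 1\<^sub>m r" "B * R_of r x = 1\<^sub>m r"
    using inverse_if_det_nonzero[OF R_of_carrier assms] by metis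
  show ?thesis
    unfolding Z_of_eq[OF B] by (rule mult_carrier_mat[OF mult_carrier_mat[OF B(1) D_of_carrier] R_of_carrier])
qed

text \<open>All these matrices are conjugates of diagonal matrices by the same \<open>R\<close>, and
  diagonal matrices commute.\<close>

lemma Z_of_commute:
  assumes "det (R_of r x) \<noteq> 0"
  shows "Z_of r x k * Z_of r x l = Z_of r x l * Z_of r x k"
proof -
  let ?R = "R_of r x"
  obtain B where B: "B \<in> carrier_mat r r" "?R * B = 1\<^sub>m r" "B * ?R = 1\<^sub>m r"
    using inverse_if_det_nonzero[OF R_of_carrier assms] by metis
  have prod: "Z_of r x k * Z_of r x l = B * (D_of r x k * D_of r x l) * ?R" for k l
  proof -
    let ?D = "D_of r x k" and ?E = "D_of r x l"
    have BD: "B * ?D \<in> carrier_mat r r" and ER: "?E * ?R \<in> carrier_mat r r"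
      and BER: "B * (?E * ?R) \<in> carrier_mat r r"
      using B(1) by auto
    have "Z_of r x k * Z_of r x l = (B * ?D * ?R) * (B * (?E * ?R))"
      using B by (simp add: Z_of_eq[OF B] assoc_mult_mat[of B r r _ r _ r])
    also have "\<dots> = B * ?D * (?R * (B * (?E * ?R)))"
      by (rule assoc_mult_mat[OF BD R_of_carrier BER])
    also have "?R * (B * (?E * ?R)) = ?E * ?R"
      by (simp only: assoc_mult_mat[OF R_of_carrier B(1) ER, symmetric] B(2) left_mult_one_mat[OF ER])
    also have "B * ?D * (?E * ?R) = B * (?D * ?E) * ?R"
      using B(1) by (simp add: assoc_mult_mat[of B r r _ r _ r] assoc_mult_mat[of "D_of r x k" r r _ r _ r])
    finally show ?thesis .
  qed
  have "D_of r x k * D_of r x l = D_of r x l * D_of r x k"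
    by (simp add: D_of_def mult.commute)
  then show ?thesis by (simp add: prod)
qed

text \<open>Replacing \<open>R\<^sup>-\<^sup>1\<close> by the adjugate makes the entries polynomial, at the cost of a factor \<open>det R\<close>.\<close>

definition adj_A_of :: "nat \<Rightarrow> nat \<Rightarrow> 'a::field vec \<Rightarrow> nat \<Rightarrow> 'a mat" where
  "adj_A_of n r x k = top_left_block n (adj_mat (R_of r x) * D_of r x k * R_of r x)"

lemma adj_A_of_eq:
  assumes "n \<le> r" and det: "det (R_of r x) \<noteq> 0"
  shows "adj_A_of n r x k = det (R_of r x) \<cdot>\<^sub>m A_of n r x k"
proof -
  let ?R = "R_of r x" and ?D = "D_of r x k"
  obtain B where B: "B \<in> carrier_mat r r" "?R * B = 1\<^sub>m r" "B * ?R = 1\<^sub>m r"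
    using inverse_if_det_nonzero[OF R_of_carrier det] by metis
  note adj = adj_mat[OF R_of_carrier[of r x]]
  have "adj_mat ?R = adj_mat ?R * (?R * B)" using adj(1) B by simp
  also have "\<dots> = (adj_mat ?R * ?R) * B" by (rule assoc_mult_mat[OF adj(1) R_of_carrier B(1), symmetric])
  also have "\<dots> = det ?R \<cdot>\<^sub>m B" using B(1) by (simp add: adj(3) mult_smult_assoc_mat[of _ r r])
  finally have adj_eq: "adj_mat ?R = det ?R \<cdot>\<^sub>m B" .
  have BD: "B * ?D \<in> carrier_mat r r" and BDR: "B * ?D * ?R \<in> carrier_mat r r"
    using mult_carrier_mat[OF B(1) D_of_carrier] by auto
  have "adj_mat ?R * ?D * ?R = det ?R \<cdot>\<^sub>m (B * ?D * ?R)"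
    unfolding adj_eq mult_smult_assoc_mat[OF B(1) D_of_carrier] mult_smult_assoc_mat[OF BD R_of_carrier] ..
  then show ?thesis
    unfolding adj_A_of_def A_of_def Z_of_eq[OF B]
    using assms(1) carrier_matD[OF BDR]
    by (intro eq_matI) (simp_all add: top_left_block_def del: index_mult_mat(1))
qed

lemma commutator_smult:
  fixes A B :: "'a::comm_ring_1 mat"
  assumes "A \<in> carrier_mat n n" "B \<in> carrier_mat n n"
  shows "commutator (d \<cdot>\<^sub>m A) (d \<cdot>\<^sub>m B) = d\<^sup>2 \<cdot>\<^sub>m commutator A B"
proof -
  have prod: "(d \<cdot>\<^sub>m M) * (d \<cdot>\<^sub>m M') = d\<^sup>2 \<cdot>\<^sub>m (M * M')"
    if "M \<in> carrier_mat n n" "M' \<in> carrier_mat n n" for M M' :: "'a mat"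
    using that by (intro eq_matI) (simp_all add: mult_smult_assoc_mat[of _ n n _ n]
        mult_smult_distrib[of _ n n _ n] power2_eq_square mult.assoc del: index_mult_mat(1))
  show ?thesis
    unfolding commutator_def prod[OF assms] prod[OF assms(2,1)]
    using assms by (intro eq_matI) (simp_all add: right_diff_distrib del: index_mult_mat(1))
qed

text \<open>The columns lie in Im [A,B] + Im [A,C], with \<open>Q1\<close> and \<open>Q2\<close>
  selecting them. For \<open>C = B\<close> they lie in Im [A,B], so one construction serves both
  dimension claims.\<close>

definition commutator_comb :: "'a::field mat \<Rightarrow> 'a mat \<Rightarrow> 'a mat \<Rightarrow> 'a mat \<Rightarrow> 'a mat \<Rightarrow> 'a mat" where
  "commutator_comb Q1 Q2 A B C = commutator A B * Q1 + commutator A C * Q2"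

lemma commutator_comb_carrier [simp]:
  assumes "Q1 \<in> carrier_mat n c" "Q2 \<in> carrier_mat n c"
    "A \<in> carrier_mat n n" "B \<in> carrier_mat n n" "C \<in> carrier_mat n n"
  shows "commutator_comb Q1 Q2 A B C \<in> carrier_mat n c"
  unfolding commutator_comb_def using assms
  by (intro add_carrier_mat mult_carrier_mat_square commutator_carrier)

lemma commutator_comb_smult:
  assumes "Q1 \<in> carrier_mat n c" "Q2 \<in> carrier_mat n c"
    "A \<in> carrier_mat n n" "B \<in> carrier_mat n n" "C \<in> carrier_mat n n"
  shows "commutator_comb Q1 Q2 (d \<cdot>\<^sub>m A) (d \<cdot>\<^sub>m B) (d \<cdot>\<^sub>m C) = d\<^sup>2 \<cdot>\<^sub>m commutator_comb Q1 Q2 A B C"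
proof -
  have M: "commutator A B \<in> carrier_mat n n" "commutator A C \<in> carrier_mat n n"
    using assms by auto
  show ?thesis
    unfolding commutator_comb_def commutator_smult[OF assms(3,4)] commutator_smult[OF assms(3,5)]
      mult_smult_assoc_mat[OF M(1) assms(1)] mult_smult_assoc_mat[OF M(2) assms(2)]
    using M assms(1,2) by (intro add_smult_distrib_left_mat[symmetric]) auto
qed

lemma commutator_comb_mult_vec:
  assumes Q: "Q1 \<in> carrier_mat n c" "Q2 \<in> carrier_mat n c"
    and ABC: "A \<in> carrier_mat n n" "B \<in> carrier_mat n n" "C \<in> carrier_mat n n"
    and v: "v \<in> carrier_vec c"
  shows "commutator_comb Q1 Q2 A B C *\<^sub>v v =
    commutator A B *\<^sub>v (Q1 *\<^sub>v v) + commutator A C *\<^sub>v (Q2 *\<^sub>v v)"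
proof -
  have M: "commutator A B \<in> carrier_mat n n" "commutator A C \<in> carrier_mat n n"
    using ABC by auto
  have "(commutator A B * Q1 + commutator A C * Q2) *\<^sub>v v =
      (commutator A B * Q1) *\<^sub>v v + (commutator A C * Q2) *\<^sub>v v"
    using M Q v by (intro add_mult_distrib_mat_vec) auto
  then show ?thesis
    by (simp add: commutator_comb_def assoc_mult_mat_vec[OF M(1) Q(1) v]
        assoc_mult_mat_vec[OF M(2) Q(2) v])
qed

section \<open>Determinant conditions as polynomials in the coordinates\<close>

lemma polyfun_mat_R_of: "polyfun_mat (r ^ 2 + p * r) r r (R_of r)"
  unfolding R_of_def
proof (rule polyfun_mat_mat)
  fix i j assume ij: "i < r" "j < r"
  then have "i * r + j < Suc i * r" by simp
  also have "\<dots> \<le> r * r" using ij by (intro mult_le_mono1) simp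
  finally have "i * r + j < r ^ 2 + p * r" by (simp add: power2_eq_square)
  then show "polyfun (r ^ 2 + p * r) (\<lambda>x. case (i, j) of (i, j) \<Rightarrow> x $ (i * r + j))"
    by (simp add: polyfun_coord)
qed

lemma polyfun_mat_D_of:
  assumes "k < p"
  shows "polyfun_mat (r ^ 2 + p * r) r r (\<lambda>x. D_of r x k)"
  unfolding D_of_def mat_diag_def
proof (rule polyfun_mat_mat)
  fix i j assume ij: "i < r" "j < r"
  then have "k * r + j < Suc k * r" by simp
  also have "\<dots> \<le> p * r" using assms by (intro mult_le_mono1) simp
  finally show "polyfun (r ^ 2 + p * r)
      (\<lambda>x. case (i, j) of (i, j) \<Rightarrow> if i = j then x $ (r ^ 2 + k * r + j) else 0)"
    by (cases "i = j") (auto simp: polyfun_const intro!: polyfun_coord)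
qed

lemma polyfun_mat_adj_A_of:
  assumes "n \<le> r" "k < p"
  shows "polyfun_mat (r ^ 2 + p * r) n n (\<lambda>x :: 'a::field vec. adj_A_of n r x k)"
proof -
  have "polyfun_mat (r ^ 2 + p * r) r r (\<lambda>x :: 'a vec. adj_mat (R_of r x) * D_of r x k * R_of r x)"
    using assms(2) by (intro polyfun_mat_mult[where b = r] polyfun_mat_adj polyfun_mat_R_of polyfun_mat_D_of)
  then show ?thesis
    unfolding adj_A_of_def top_left_block_def using assms(1)
    by (intro polyfun_mat_mat) (simp add: polyfun_mat_def del: index_mult_mat(1))
qed

text \<open>The polynomial is det R times the given determinant with the inverse replaced by the
  adjugate. Where det R is nonzero, this replacement only rescales the determinant by a power of det
  R, so a single good point suffices.\<close>

lemma basic_generic_commutator_comb: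
  fixes P Q1 Q2 :: "'a::field mat"
  assumes "n \<le> r" and klm: "k < p" "l < p" "m < p"
    and P: "P \<in> carrier_mat c n" and Q: "Q1 \<in> carrier_mat n c" "Q2 \<in> carrier_mat n c"
    and x0: "x0 \<in> carrier_vec (r ^ 2 + p * r)" "det (R_of r x0) \<noteq> 0"
      "det (P * commutator_comb Q1 Q2 (A_of n r x0 k) (A_of n r x0 l) (A_of n r x0 m)) \<noteq> 0"
  shows "basic_generic (r ^ 2 + p * r) (\<lambda>x. det (R_of r x) \<noteq> 0 \<and>
    det (P * commutator_comb Q1 Q2 (A_of n r x k) (A_of n r x l) (A_of n r x m)) \<noteq> 0)"
proof -
  let ?N = "r ^ 2 + p * r"
  define f where "f x = det (R_of r x) *
    det (P * commutator_comb Q1 Q2 (adj_A_of n r x k) (adj_A_of n r x l) (adj_A_of n r x m))" for x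
  have "polyfun ?N f"
    unfolding f_def commutator_comb_def commutator_def using assms
    by (intro polyfun_mult polyfun_det[where a = r] polyfun_det[where a = c] polyfun_mat_R_of
        polyfun_mat_mult[where b = n] polyfun_mat_const
        polyfun_mat_add polyfun_mat_minus polyfun_mat_adj_A_of)
  moreover have "f x \<noteq> 0 \<longleftrightarrow> det (R_of r x) \<noteq> 0 \<and>
    det (P * commutator_comb Q1 Q2 (A_of n r x k) (A_of n r x l) (A_of n r x m)) \<noteq> 0" for x
  proof (cases "det (R_of r x) = 0")
    case False
    have S: "commutator_comb Q1 Q2 (A_of n r x k) (A_of n r x l) (A_of n r x m) \<in> carrier_mat n c"
      using Q by simp
    \<comment> \<open>\<open>commutator_comb\<close> is quadratic in the blocks, hence the square of
      det R; a determinant of size \<open>c\<close> raises it to the power \<open>c\<close>.\<close>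
    have "f x = det (R_of r x) * ((det (R_of r x))\<^sup>2 ^ c *
        det (P * commutator_comb Q1 Q2 (A_of n r x k) (A_of n r x l) (A_of n r x m)))"
      unfolding f_def adj_A_of_eq[OF \<open>n \<le> r\<close> False]
      using commutator_comb_smult[OF Q, of "A_of n r x k" "A_of n r x l" "A_of n r x m"] S
      by (simp add: mult_smult_distrib[OF P S])
    then show ?thesis using False by simp
  qed (simp add: f_def)
  ultimately show ?thesis
    unfolding basic_generic_def using x0 by (intro exI[of _ f]) auto
qed

text \<open>Inverse to the layout read by \<open>R_of\<close> and \<open>D_of\<close>: quotient and
  remainder by \<open>r\<close> recover row and column, or the index of the diagonal matrix and the
  position on its diagonal.\<close>

definition point_of :: "nat \<Rightarrow> nat \<Rightarrow> 'a mat \<Rightarrow> (nat \<Rightarrow> nat \<Rightarrow> 'a) \<Rightarrow> 'a vec" where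
  "point_of r p R d = vec (r ^ 2 + p * r) (\<lambda>e. if e < r ^ 2 then R $$ (e div r, e mod r)
     else d ((e - r ^ 2) div r) ((e - r ^ 2) mod r))"

lemma point_of_carrier [simp]: "point_of r p R d \<in> carrier_vec (r ^ 2 + p * r)"
  by (simp add: point_of_def)

lemma R_of_point_of:
  assumes "R \<in> carrier_mat r r"
  shows "R_of r (point_of r p R d) = R"
proof (rule eq_matI)
  fix i j assume "i < dim_row R" "j < dim_col R"
  then have ij: "i < r" "j < r" using assms by auto
  then have "i * r + j < Suc i * r" by simp
  also have "\<dots> \<le> r * r" using ij by (intro mult_le_mono1) simp
  finally have "i * r + j < r ^ 2" by (simp add: power2_eq_square)
  then show "R_of r (point_of r p R d) $$ (i, j) = R $$ (i, j)"
    using ij by (simp add: R_of_def point_of_def)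
qed (use assms in \<open>auto simp: R_of_def\<close>)

lemma D_of_point_of:
  assumes "k < p"
  shows "D_of r (point_of r p R d) k = mat_diag r (d k)"
proof -
  have "r ^ 2 + k * r + j < r ^ 2 + p * r" if "j < r" for j
  proof -
    have "k * r + j < Suc k * r" using that by simp
    also have "\<dots> \<le> p * r" using assms by (intro mult_le_mono1) simp
    finally show ?thesis by simp
  qed
  then show ?thesis
    by (intro eq_matI) (auto simp: D_of_def mat_diag_def point_of_def)
qed

section \<open>From nonzero determinants to dimensions\<close>

lemma Im_mat_eq:
  assumes "M \<in> carrier_mat n n"
  shows "Im_mat n M = {M *\<^sub>v v | v. v \<in> carrier_vec n}"
  using vec_space.col_space_eq[OF assms] assms unfolding Im_mat_def by auto

lemma subspace_sum_eq:
  "subspace_sum n V W = {v + w | v w. v \<in> V \<and> w \<in> W}"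
proof -
  interpret vec_space "TYPE('a)" n .
  show ?thesis
    unfolding subspace_sum_def submodule_sum_def by (auto simp: module_vec_simps)
qed

text \<open>The upper bound comes from the \<open>2 * s\<close> columns of the two top right blocks,
  the lower bound from \<open>commutator_comb\<close> with equal last arguments, whose columns all
  lie in one image.\<close>

lemma dim_Im_commutator:
  fixes x :: "'a::field vec"
  assumes det: "det (R_of (n + s) x) \<noteq> 0"
    and P: "P \<in> carrier_mat (2 * s) n"
    and Q: "Q1 \<in> carrier_mat n (2 * s)" "Q2 \<in> carrier_mat n (2 * s)"
    and det': "det (P * commutator_comb Q1 Q2 (A_of n (n + s) x k) (A_of n (n + s) x l)
      (A_of n (n + s) x l)) \<noteq> 0"
  shows "subspace_dim n (Im_mat n (commutator (A_of n (n + s) x k) (A_of n (n + s) x l))) = 2 * s"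
proof -
  let ?Z = "Z_of (n + s) x"
  let ?B = "\<lambda>k. top_right_block n s (?Z k)"
  let ?M = "commutator (A_of n (n + s) x k) (A_of n (n + s) x l)"
  let ?S = "commutator_comb Q1 Q2 (A_of n (n + s) x k) (A_of n (n + s) x l) (A_of n (n + s) x l)"
  have M: "?M \<in> carrier_mat n n" by simp
  have B: "set (cols (?B k)) \<subseteq> carrier_vec n" "length (cols (?B k)) = s" for k
    using cols_dim[of "?B k"] by (auto simp: top_right_block_def)
  show ?thesis
  proof (rule subspace_dim_eqI[where S = ?S and ws = "cols (?B k) @ cols (?B l)"])
    show "Im_mat n ?M \<subseteq> LinearCombinations.module.span class_ring (module_vec TYPE('a) n)
        (set (cols (?B k) @ cols (?B l)))"
      unfolding Im_mat_eq[OF M] unfolding A_of_def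
      using commutator_range_subset_span[OF Z_of_carrier[OF det] Z_of_carrier[OF det]
          Z_of_commute[OF det]] by blast
    fix v :: "'a vec" assume v: "v \<in> carrier_vec (2 * s)"
    have "?S *\<^sub>v v = ?M *\<^sub>v (Q1 *\<^sub>v v + Q2 *\<^sub>v v)"
      unfolding commutator_comb_mult_vec[OF Q A_of_carrier A_of_carrier A_of_carrier v]
      using v Q by (simp add: mult_add_distrib_mat_vec[of _ n n])
    then show "?S *\<^sub>v v \<in> Im_mat n ?M"
      unfolding Im_mat_eq[OF M] using v Q by auto
  qed (use B P Q det' in auto)
qed

text \<open>The top right block belonging to \<open>k\<close> occurs in both commutators, so three
  blocks of \<open>s\<close> columns, not four, span the sum.\<close>

lemma dim_sum_Im_commutators:
  fixes x :: "'a::field vec"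
  assumes det: "det (R_of (n + s) x) \<noteq> 0"
    and P: "P \<in> carrier_mat (3 * s) n"
    and Q: "Q1 \<in> carrier_mat n (3 * s)" "Q2 \<in> carrier_mat n (3 * s)"
    and det': "det (P * commutator_comb Q1 Q2 (A_of n (n + s) x k) (A_of n (n + s) x l)
      (A_of n (n + s) x m)) \<noteq> 0"
  shows "subspace_dim n (subspace_sum n
      (Im_mat n (commutator (A_of n (n + s) x k) (A_of n (n + s) x l)))
      (Im_mat n (commutator (A_of n (n + s) x k) (A_of n (n + s) x m)))) = 3 * s"
proof -
  interpret V: vec_space "TYPE('a)" n .
  let ?Z = "Z_of (n + s) x"
  let ?B = "\<lambda>k. top_right_block n s (?Z k)"
  let ?ws = "cols (?B k) @ cols (?B l) @ cols (?B m)"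
  let ?M = "\<lambda>l. commutator (A_of n (n + s) x k) (A_of n (n + s) x l)"
  let ?S = "commutator_comb Q1 Q2 (A_of n (n + s) x k) (A_of n (n + s) x l) (A_of n (n + s) x m)"
  have M: "?M l \<in> carrier_mat n n" for l by simp
  have B: "set (cols (?B k)) \<subseteq> carrier_vec n" "length (cols (?B k)) = s" for k
    using cols_dim[of "?B k"] by (auto simp: top_right_block_def)
  have range: "?M l' *\<^sub>v v \<in> V.span (set ?ws)" if "l' = l \<or> l' = m" "v \<in> carrier_vec n" for l' v
  proof -
    have "?M l' *\<^sub>v v \<in> V.span (set (cols (?B k) @ cols (?B l')))"
      unfolding A_of_def
      using commutator_range_subset_span[OF Z_of_carrier[OF det] Z_of_carrier[OF det]
          Z_of_commute[OF det] that(2)] by blast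
    moreover have "V.span (set (cols (?B k) @ cols (?B l'))) \<subseteq> V.span (set ?ws)"
      using that(1) by (intro V.span_is_monotone) auto
    ultimately show ?thesis by blast
  qed
  show ?thesis
  proof (rule subspace_dim_eqI[where S = ?S and ws = ?ws])
    show "subspace_sum n (Im_mat n (?M l)) (Im_mat n (?M m)) \<subseteq> V.span (set ?ws)"
      unfolding subspace_sum_eq Im_mat_eq[OF M] using range B by (auto intro!: V.span_add1)
    fix v :: "'a vec" assume v: "v \<in> carrier_vec (3 * s)"
    have "?S *\<^sub>v v = ?M l *\<^sub>v (Q1 *\<^sub>v v) + ?M m *\<^sub>v (Q2 *\<^sub>v v)"
      by (rule commutator_comb_mult_vec[OF Q A_of_carrier A_of_carrier A_of_carrier v])
    then show "?S *\<^sub>v v \<in> subspace_sum n (Im_mat n (?M l)) (Im_mat n (?M m))"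
      unfolding subspace_sum_eq Im_mat_eq[OF M] using v Q by (auto intro!: exI)
  qed (use B P Q det' in auto)
qed

section \<open>A point of maximal rank\<close>

text \<open>
  The witness: with \<open>YX = 0\<close>, the matrix \<open>R = (1 X; Y 1)\<close> has inverse \<open>(G -X; -Y 1)\<close>, where
  \<open>G = 1 + XY\<close>. If the last \<open>s\<close> diagonal entries of \<open>D\<close> vanish, then \<open>A = G D'\<close> with
  \<open>D'\<close> the top left block of \<open>D\<close>, so that \<open>[A\<^sub>k, A\<^sub>l] = G (D'\<^sub>k G D'\<^sub>l - D'\<^sub>l G D'\<^sub>k)\<close>.
  Taking \<open>D'\<^sub>k, D'\<^sub>l, D'\<^sub>m\<close> to be the indicators of the first three blocks of \<open>s\<close> coordinates, the
  nonzero columns of the second factors are, up to sign, the first \<open>3 s\<close> unit vectors. All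
  nonzero entries that matter are \<open>1\<close> or \<open>-1\<close>, so the characteristic plays no role.
\<close>

definition X_wit :: "nat \<Rightarrow> nat \<Rightarrow> 'a::field mat" where
  "X_wit n s = mat n s (\<lambda>(i, j). if i = j \<or> i = s + j \<or> i = 2 * s + j then 1 else 0)"

text \<open>Column \<open>j\<close> of \<open>X_wit\<close> has ones in rows \<open>j\<close> and
  \<open>s + j\<close>. Row \<open>j\<close> of \<open>Y_wit\<close> takes the difference of exactly
  these coordinates, which makes YX vanish.\<close>

definition Y_wit :: "nat \<Rightarrow> nat \<Rightarrow> 'a::field mat" where
  "Y_wit n s = mat s n (\<lambda>(j, i). (if i = j then 1 else 0) - (if i = s + j then 1 else 0))"

definition G_wit :: "nat \<Rightarrow> nat \<Rightarrow> 'a::field mat" where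
  "G_wit n s = 1\<^sub>m n + X_wit n s * Y_wit n s"

definition R_wit :: "nat \<Rightarrow> nat \<Rightarrow> 'a::field mat" where
  "R_wit n s = four_block_mat (1\<^sub>m n) (X_wit n s) (Y_wit n s) (1\<^sub>m s)"

definition R_inv_wit :: "nat \<Rightarrow> nat \<Rightarrow> 'a::field mat" where
  "R_inv_wit n s = four_block_mat (G_wit n s) (- X_wit n s) (- Y_wit n s) (1\<^sub>m s)"

lemma X_wit_carrier [simp]: "X_wit n s \<in> carrier_mat n s"
  and Y_wit_carrier [simp]: "Y_wit n s \<in> carrier_mat s n"
  by (simp_all add: X_wit_def Y_wit_def)

lemma dim_X_wit [simp]: "dim_row (X_wit n s) = n" "dim_col (X_wit n s) = s"
  and dim_Y_wit [simp]: "dim_row (Y_wit n s) = s" "dim_col (Y_wit n s) = n"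
  by (simp_all add: X_wit_def Y_wit_def)

lemma XY_wit_carrier [simp]: "X_wit n s * Y_wit n s \<in> carrier_mat n n"
  by (rule mult_carrier_mat[OF X_wit_carrier Y_wit_carrier])

lemma G_wit_carrier [simp]: "G_wit n s \<in> carrier_mat n n"
  by (simp add: G_wit_def)

lemma one_minus_XY_wit_carrier [simp]: "1\<^sub>m n - X_wit n s * Y_wit n s \<in> carrier_mat n n"
  by (rule minus_carrier_mat) simp

lemma R_wit_carrier [simp]: "R_wit n s \<in> carrier_mat (n + s) (n + s)"
  and R_inv_wit_carrier [simp]: "R_inv_wit n s \<in> carrier_mat (n + s) (n + s)"
  unfolding R_wit_def R_inv_wit_def by (intro four_block_carrier_mat; simp)+

lemma Y_X_wit:
  assumes "2 * s \<le> n"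
  shows "Y_wit n s * X_wit n s = (0\<^sub>m s s :: 'a::field mat)"
proof (rule eq_matI)
  fix i j assume "i < dim_row (0\<^sub>m s s :: 'a mat)" "j < dim_col (0\<^sub>m s s :: 'a mat)"
  then have ij: "i < s" "j < s" by auto
  have "(Y_wit n s * X_wit n s) $$ (i, j) = (\<Sum>t = 0..<n. Y_wit n s $$ (i, t) * X_wit n s $$ (t, j) :: 'a)"
    using ij by (simp add: scalar_prod_def X_wit_def Y_wit_def)
  also have "\<dots> = (\<Sum>t = 0..<n. (if t = i then X_wit n s $$ (t, j) else 0)
      - (if t = s + i then X_wit n s $$ (t, j) else 0))"
    using ij by (intro sum.cong) (auto simp: Y_wit_def)
  also have "\<dots> = X_wit n s $$ (i, j) - X_wit n s $$ (s + i, j)"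
    using ij assms by (simp add: sum_subtractf)
  also have "\<dots> = 0" using ij assms by (auto simp: X_wit_def)
  finally show "(Y_wit n s * X_wit n s) $$ (i, j) = (0\<^sub>m s s :: 'a mat) $$ (i, j)"
    using ij by simp
qed (simp_all add: X_wit_def Y_wit_def)

lemma G_wit_index:
  assumes "i < n" "j < n"
  shows "G_wit n s $$ (i, j) = (if i = j then 1 else 0) + (if j < s then X_wit n s $$ (i, j)
    else if j < 2 * s then - X_wit n s $$ (i, j - s) else (0 :: 'a::field))"
proof -
  have "(X_wit n s * Y_wit n s) $$ (i, j) = (\<Sum>t = 0..<s. X_wit n s $$ (i, t) * Y_wit n s $$ (t, j) :: 'a)"
    using assms by (simp add: scalar_prod_def X_wit_def Y_wit_def)
  \<comment> \<open>Row \<open>t\<close> of Y has its entries at \<open>t\<close> and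
    \<open>s + t\<close>, so column \<open>j\<close> meets only \<open>t = j\<close> and
    \<open>t = j - s\<close>. For \<open>j < s\<close> the truncated difference is 0, hence the
    inner test.\<close>
  also have "\<dots> = (\<Sum>t = 0..<s. (if t = j then X_wit n s $$ (i, t) else 0)
      - (if t = j - s then (if s \<le> j then X_wit n s $$ (i, t) else 0) else 0))"
    using assms by (intro sum.cong) (auto simp: Y_wit_def)
  also have "\<dots> = (if j < s then X_wit n s $$ (i, j)
    else if j < 2 * s then - X_wit n s $$ (i, j - s) else 0)"
    by (auto simp: sum_subtractf)
  finally show ?thesis
    using assms by (simp add: G_wit_def del: index_mult_mat(1))
qed

text \<open>The upper blocks of the product cancel by the form of G; the lower ones are YXY and 1 -
  YX, which YX = 0 turns into 0 and 1.\<close>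

lemma R_wit_inverse:
  assumes "2 * s \<le> n"
  shows "R_wit n s * R_inv_wit n s = (1\<^sub>m (n + s) :: 'a::field mat)"
proof -
  let ?X = "X_wit n s :: 'a mat" and ?Y = "Y_wit n s :: 'a mat" and ?G = "G_wit n s :: 'a mat"
  have YXY: "?Y * (?X * ?Y) = 0\<^sub>m s n"
    by (simp add: assoc_mult_mat[OF Y_wit_carrier X_wit_carrier Y_wit_carrier, symmetric] Y_X_wit[OF assms]
        left_mult_zero_mat[OF Y_wit_carrier])
  have *: "A + - A = 0\<^sub>m a b" if "A \<in> carrier_mat a b" for A :: "'a mat" and a b
    using that by (intro eq_matI) auto
  have 1: "1\<^sub>m n * ?G + ?X * (- ?Y) = 1\<^sub>m n"
    unfolding left_mult_one_mat[OF G_wit_carrier]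
    by (simp add: G_wit_def assoc_add_mat[OF one_carrier_mat XY_wit_carrier] *[OF XY_wit_carrier])
  have 2: "1\<^sub>m n * (- ?X) + ?X * 1\<^sub>m s = 0\<^sub>m n s"
    by (simp add: comm_add_mat[of "- ?X" n s] *[OF X_wit_carrier])
  have 3: "?Y * ?G + 1\<^sub>m s * (- ?Y) = 0\<^sub>m s n"
    by (simp add: G_wit_def mult_add_distrib_mat[OF Y_wit_carrier one_carrier_mat XY_wit_carrier] YXY *[OF Y_wit_carrier])
  have 4: "?Y * (- ?X) + 1\<^sub>m s * 1\<^sub>m s = 1\<^sub>m s"
    using Y_X_wit[OF assms, where 'a = 'a] by (intro eq_matI) auto
  have "R_wit n s * R_inv_wit n s = four_block_mat (1\<^sub>m n * ?G + ?X * (- ?Y))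
      (1\<^sub>m n * (- ?X) + ?X * 1\<^sub>m s) (?Y * ?G + 1\<^sub>m s * (- ?Y)) (?Y * (- ?X) + 1\<^sub>m s * 1\<^sub>m s)"
    unfolding R_wit_def R_inv_wit_def by (intro mult_four_block_mat) auto
  then show ?thesis by (simp only: 1 2 3 4 four_block_one_mat)
qed

text \<open>As YX = 0, the matrix XY squares to zero, so 1 - XY inverts 1 + XY.\<close>

lemma G_wit_left_inverse:
  assumes "2 * s \<le> n"
  shows "(1\<^sub>m n - X_wit n s * Y_wit n s) * G_wit n s = (1\<^sub>m n :: 'a::field mat)"
proof -
  let ?X = "X_wit n s :: 'a mat" and ?Y = "Y_wit n s :: 'a mat"
  let ?XY = "?X * ?Y"
  have "?Y * ?XY = 0\<^sub>m s n"
    by (simp add: assoc_mult_mat[OF Y_wit_carrier X_wit_carrier Y_wit_carrier, symmetric] Y_X_wit[OF assms]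
        left_mult_zero_mat[OF Y_wit_carrier])
  then have XYXY: "?XY * ?XY = 0\<^sub>m n n"
    by (simp add: assoc_mult_mat[OF X_wit_carrier Y_wit_carrier XY_wit_carrier]
        right_mult_zero_mat[OF X_wit_carrier])
  have "(1\<^sub>m n - ?XY) * G_wit n s = 1\<^sub>m n * G_wit n s - ?XY * G_wit n s"
    by (rule minus_mult_distrib_mat[of _ n n _ _ n]) auto
  also have "?XY * G_wit n s = ?XY"
    using XYXY by (simp add: G_wit_def mult_add_distrib_mat[OF XY_wit_carrier one_carrier_mat XY_wit_carrier])
  also have "1\<^sub>m n * G_wit n s - ?XY = 1\<^sub>m n"
    by (intro eq_matI) (simp_all add: G_wit_def X_wit_def Y_wit_def del: index_mult_mat(1))
  finally show ?thesis .
qed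

text \<open>The tests are made in order, so \<open>m = l\<close> leaves the matrices for
  \<open>k\<close> and \<open>l\<close> unchanged.\<close>

definition diag_wit :: "nat \<Rightarrow> nat \<Rightarrow> nat \<Rightarrow> nat \<Rightarrow> nat \<Rightarrow> nat \<Rightarrow> nat \<Rightarrow> 'a::field" where
  "diag_wit n s k l m q i =
    (if n \<le> i then 0
     else if q = k then (if i < s then 1 else 0)
     else if q = l then (if s \<le> i \<and> i < 2 * s then 1 else 0)
     else if q = m then (if 2 * s \<le> i \<and> i < 3 * s then 1 else 0)
     else 0)"

lemma A_of_wit:
  assumes "2 * s \<le> n" "q < p"
  shows "A_of n (n + s) (point_of (n + s) p (R_wit n s) (diag_wit n s k l m)) q =
    G_wit n s * mat_diag n (diag_wit n s k l m q :: nat \<Rightarrow> 'a::field)"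
proof -
  let ?r = "n + s" and ?d = "diag_wit n s k l m q :: nat \<Rightarrow> 'a"
  let ?x = "point_of ?r p (R_wit n s) (diag_wit n s k l m) :: 'a vec"
  have R: "R_of ?r ?x = R_wit n s" by (simp add: R_of_point_of)
  have D: "D_of ?r ?x q = mat_diag ?r ?d" using assms(2) by (rule D_of_point_of)
  have inv: "R_inv_wit n s * R_wit n s = (1\<^sub>m ?r :: 'a mat)"
    by (rule mat_mult_left_right_inverse[OF R_wit_carrier R_inv_wit_carrier R_wit_inverse[OF assms(1)]])
  have Z: "Z_of ?r ?x q = R_inv_wit n s * mat_diag ?r ?d * R_wit n s"
    using Z_of_eq[OF R_inv_wit_carrier, of n s ?x q] R_wit_inverse[OF assms(1), where 'a = 'a] inv
    by (simp add: R D)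
  show ?thesis
    unfolding A_of_def Z mat_diag_mult_right[OF R_inv_wit_carrier] mat_diag_mult_right[OF G_wit_carrier]
  proof (rule eq_matI)
    fix i j
    assume "i < dim_row (mat n n (\<lambda>(i, j). G_wit n s $$ (i, j) * ?d j))"
      and "j < dim_col (mat n n (\<lambda>(i, j). G_wit n s $$ (i, j) * ?d j))"
    then have ij: "i < n" "j < n" by auto
    have "(mat ?r ?r (\<lambda>(i, j). R_inv_wit n s $$ (i, j) * ?d j) * R_wit n s) $$ (i, j)
        = (\<Sum>t = 0..<?r. R_inv_wit n s $$ (i, t) * ?d t * R_wit n s $$ (t, j))"
      using ij carrier_matD[OF R_wit_carrier[of n s, where 'a = 'a]] by (simp add: scalar_prod_def)
    \<comment> \<open>Terms with \<open>t \<ge> n\<close> vanish with the diagonal; for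
      \<open>t < n\<close> the top left block of R is the identity, which leaves only
      \<open>t = j\<close>.\<close>
    also have "\<dots> = (\<Sum>t = 0..<?r. if t = j then R_inv_wit n s $$ (i, j) * ?d j else 0)"
      using ij by (intro sum.cong) (auto simp: R_wit_def diag_wit_def X_wit_def Y_wit_def)
    also have "\<dots> = G_wit n s $$ (i, j) * ?d j"
      using ij carrier_matD[OF G_wit_carrier[of n s, where 'a = 'a]] by (simp add: R_inv_wit_def)
    finally show "top_left_block n (mat ?r ?r (\<lambda>(i, j). R_inv_wit n s $$ (i, j) * ?d j) * R_wit n s) $$ (i, j)
        = mat n n (\<lambda>(i, j). G_wit n s $$ (i, j) * ?d j) $$ (i, j)"
      using ij by (simp add: top_left_block_def del: index_mult_mat(1))
  qed (simp_all add: top_left_block_def)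
qed

text \<open>The leading \<open>G\<close> factors out of both products; the remaining difference is
  computed entrywise.\<close>

lemma commutator_mult_diag:
  fixes G :: "'a::field mat"
  assumes G: "G \<in> carrier_mat n n"
  shows "commutator (G * mat_diag n d) (G * mat_diag n e) =
    G * mat n n (\<lambda>(i, j). G $$ (i, j) * (d i * e j - e i * d j))"
proof -
  have prod: "(G * mat_diag n d) * (G * mat_diag n e) = G * mat n n (\<lambda>(i, j). d i * G $$ (i, j) * e j)"
    for d e :: "nat \<Rightarrow> 'a"
  proof -
    have "mat_diag n d * (G * mat_diag n e) = mat n n (\<lambda>(i, j). d i * G $$ (i, j) * e j)"
      unfolding mat_diag_mult_right[OF G]
      by (subst mat_diag_mult_left[of _ n n]) (auto simp: mult.assoc)
    moreover have "G * mat_diag n e \<in> carrier_mat n n" using G by simp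
    ultimately show ?thesis by (simp only: assoc_mult_mat[OF G mat_diag_dim])
  qed
  have "commutator (G * mat_diag n d) (G * mat_diag n e) =
      G * (mat n n (\<lambda>(i, j). d i * G $$ (i, j) * e j) - mat n n (\<lambda>(i, j). e i * G $$ (i, j) * d j))"
    unfolding commutator_def prod by (rule mult_minus_distrib_mat[OF G, symmetric]) auto
  also have "mat n n (\<lambda>(i, j). d i * G $$ (i, j) * e j) - mat n n (\<lambda>(i, j). e i * G $$ (i, j) * d j) =
      mat n n (\<lambda>(i, j). G $$ (i, j) * (d i * e j - e i * d j))"
    by (intro eq_matI) (auto simp: algebra_simps)
  finally show ?thesis .
qed

text \<open>The factor 1 - XY undoes the leading G of the commutators; the rectangular factor keeps
  the first \<open>c\<close> coordinates.\<close>

definition P_wit :: "nat \<Rightarrow> nat \<Rightarrow> nat \<Rightarrow> 'a::field mat" where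
  "P_wit n s c = mat c n (\<lambda>(i, j). if i = j then 1 else 0) * (1\<^sub>m n - X_wit n s * Y_wit n s)"

text \<open>With G removed, the commutator for \<open>k\<close> and \<open>l\<close> exchanges the
  unit vectors \<open>t\<close> and \<open>t + s\<close>, for \<open>t < s\<close>, up to the sign
  -1. This matrix reverses that exchange; its zero columns leave the third block to
  \<open>Q2_wit\<close>.\<close>

definition Q1_wit :: "nat \<Rightarrow> nat \<Rightarrow> nat \<Rightarrow> 'a::field mat" where
  "Q1_wit n s c = mat n c (\<lambda>(j, t). if j = (if t < s then t + s else t - s) then (if t < 2 * s then - 1 else 0) else 0)"

text \<open>With G removed, the commutator for \<open>k\<close> and \<open>m\<close> sends the unit
  vector \<open>t - 2 * s\<close> to minus the unit vector \<open>t\<close>, for \<open>t\<close> in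
  the third block. For \<open>c = 2 * s\<close> this matrix is zero.\<close>

definition Q2_wit :: "nat \<Rightarrow> nat \<Rightarrow> nat \<Rightarrow> 'a::field mat" where
  "Q2_wit n s c = mat n c (\<lambda>(j, t). if j = t - 2 * s then (if 2 * s \<le> t then - 1 else 0) else 0)"

lemma P_wit_carrier [simp]: "P_wit n s c \<in> carrier_mat c n"
  and Q1_wit_carrier [simp]: "Q1_wit n s c \<in> carrier_mat n c"
  and Q2_wit_carrier [simp]: "Q2_wit n s c \<in> carrier_mat n c"
  unfolding P_wit_def Q1_wit_def Q2_wit_def by (auto intro!: mult_carrier_mat[of _ c n] minus_carrier_mat)

text \<open>For \<open>c = 2 * s\<close> only the commutator for \<open>k\<close> and
  \<open>l\<close> contributes, so \<open>m\<close> may equal \<open>l\<close>. Reaching the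
  identity matrix gives determinant 1 in every characteristic.\<close>

lemma P_wit_commutator_comb:
  fixes x :: "'a::field vec"
  assumes kl: "k \<noteq> l" "k < p" "l < p" "m < p" and cn: "c \<le> n"
    and c: "c = 2 * s \<or> c = 3 * s \<and> k \<noteq> m \<and> l \<noteq> m"
    and x: "x = point_of (n + s) p (R_wit n s) (diag_wit n s k l m)"
  shows "P_wit n s c * commutator_comb (Q1_wit n s c) (Q2_wit n s c)
    (A_of n (n + s) x k) (A_of n (n + s) x l) (A_of n (n + s) x m) = 1\<^sub>m c"
proof -
  have sn: "2 * s \<le> n" using c cn by auto
  let ?G = "G_wit n s :: 'a mat" and ?d = "diag_wit n s k l m :: nat \<Rightarrow> nat \<Rightarrow> 'a"
  let ?Q1 = "Q1_wit n s c :: 'a mat" and ?Q2 = "Q2_wit n s c :: 'a mat"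
  define M where "M q = mat n n (\<lambda>(i, j). ?G $$ (i, j) * (?d k i * ?d q j - ?d q i * ?d k j))" for q
  have M: "M q \<in> carrier_mat n n" for q by (simp add: M_def)
  define U where "U = M l * ?Q1 + M m * ?Q2"
  have U: "U \<in> carrier_mat n c" by (simp add: U_def M)
  have comm: "commutator (A_of n (n + s) x k) (A_of n (n + s) x q) = ?G * M q" if "q < p" for q
    unfolding x A_of_wit[OF sn kl(2)] A_of_wit[OF sn that] M_def
    by (rule commutator_mult_diag) simp
  have S: "commutator_comb ?Q1 ?Q2 (A_of n (n + s) x k) (A_of n (n + s) x l) (A_of n (n + s) x m) = ?G * U"
    unfolding commutator_comb_def comm[OF kl(3)] comm[OF kl(4)] U_def
      assoc_mult_mat[OF G_wit_carrier M Q1_wit_carrier] assoc_mult_mat[OF G_wit_carrier M Q2_wit_carrier]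
    by (rule mult_add_distrib_mat[symmetric, of _ n n _ c]) (auto simp: M)
  have "P_wit n s c * (?G * U) = mat c n (\<lambda>(i, j). if i = j then 1 else 0) *
      ((1\<^sub>m n - X_wit n s * Y_wit n s) * (?G * U))"
    unfolding P_wit_def by (rule assoc_mult_mat[of _ c n _ n _ c]) (auto simp: U)
  also have "(1\<^sub>m n - X_wit n s * Y_wit n s) * (?G * U) = ((1\<^sub>m n - X_wit n s * Y_wit n s) * ?G) * U"
    by (rule assoc_mult_mat[symmetric, of _ n n _ n _ c]) (auto simp: U)
  also have "\<dots> = U" using U by (simp add: G_wit_left_inverse[OF sn])
  also have "mat c n (\<lambda>(i, j). if i = j then 1 else 0) * U = 1\<^sub>m c"
  proof (rule eq_matI)
    fix i t assume "i < dim_row (1\<^sub>m c :: 'a mat)" "t < dim_col (1\<^sub>m c :: 'a mat)"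
    then have it: "i < c" "t < c" by auto
    have "(mat c n (\<lambda>(i, j). if i = j then 1 else 0) * U) $$ (i, t) =
        (\<Sum>j = 0..<n. (if i = j then 1 else 0) * U $$ (j, t))"
      using it U by (simp add: scalar_prod_def)
    also have "\<dots> = (\<Sum>j = 0..<n. if j = i then U $$ (j, t) else 0)"
      by (intro sum.cong) auto
    also have "\<dots> = U $$ (i, t)" using it cn by simp
    also have "\<dots> = (\<Sum>j = 0..<n. M l $$ (i, j) * ?Q1 $$ (j, t)) + (\<Sum>j = 0..<n. M m $$ (i, j) * ?Q2 $$ (j, t))"
      using it cn carrier_matD[OF M] by (simp add: U_def scalar_prod_def Q1_wit_def Q2_wit_def)
    also have "(\<Sum>j = 0..<n. M l $$ (i, j) * ?Q1 $$ (j, t)) =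
        (\<Sum>j = 0..<n. if j = (if t < s then t + s else t - s) then (if t < 2 * s then - M l $$ (i, j) else 0) else 0)"
      using it by (intro sum.cong) (auto simp: Q1_wit_def)
    also have "\<dots> = (if t < s then - M l $$ (i, t + s) else if t < 2 * s then - M l $$ (i, t - s) else 0)"
      using it cn sn by auto
    also have "(\<Sum>j = 0..<n. M m $$ (i, j) * ?Q2 $$ (j, t)) =
        (\<Sum>j = 0..<n. if j = t - 2 * s then (if 2 * s \<le> t then - M m $$ (i, j) else 0) else 0)"
      using it by (intro sum.cong) (auto simp: Q2_wit_def)
    also have "\<dots> = (if 2 * s \<le> t then - M m $$ (i, t - 2 * s) else 0)"
      using it cn by auto
    also have "(if t < s then - M l $$ (i, t + s) else if t < 2 * s then - M l $$ (i, t - s) else 0)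
        + (if 2 * s \<le> t then - M m $$ (i, t - 2 * s) else 0) = (if i = t then 1 else 0)"
    proof -
      \<comment> \<open>In each block of columns a single entry of G survives:
        \<open>G(t, t + s) = -1\<close>, \<open>G(t, t - s) = 1\<close> and
        \<open>G(t, t - 2 * s) = 1\<close> respectively; the signs in Q1, Q2 and \<open>M\<close>
        make the result 1.\<close>
      consider "t < s" | "s \<le> t" "t < 2 * s" | "2 * s \<le> t" "c = 3 * s" "k \<noteq> m" "l \<noteq> m"
        using it c by linarith
      then show ?thesis
      proof cases
        case 1
        then show ?thesis using it cn sn kl
          by (auto simp: M_def G_wit_index diag_wit_def X_wit_def)
      next
        case 2
        then show ?thesis using it cn sn kl
          by (auto simp: M_def G_wit_index diag_wit_def X_wit_def)
      next
        case 3
        then show ?thesis using it cn sn kl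
          by (auto simp: M_def G_wit_index diag_wit_def X_wit_def)
      qed
    qed
    finally show "(mat c n (\<lambda>(i, j). if i = j then 1 else 0) * U) $$ (i, t) = 1\<^sub>m c $$ (i, t)"
      using it by simp
  qed (use U in auto)
  finally show ?thesis unfolding S .
qed

section \<open>Imposing all conditions at once\<close>

lemma basic_generic_wit:
  fixes n s p :: nat
  assumes kl: "k \<noteq> l" "k < p" "l < p" "m < p" and cn: "c \<le> n"
    and c: "c = 2 * s \<or> c = 3 * s \<and> k \<noteq> m \<and> l \<noteq> m"
  shows "basic_generic ((n + s) ^ 2 + p * (n + s)) (\<lambda>x :: 'a::field vec. det (R_of (n + s) x) \<noteq> 0 \<and>
    det (P_wit n s c * commutator_comb (Q1_wit n s c) (Q2_wit n s c)
      (A_of n (n + s) x k) (A_of n (n + s) x l) (A_of n (n + s) x m)) \<noteq> 0)"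
proof -
  let ?x = "point_of (n + s) p (R_wit n s) (diag_wit n s k l m) :: 'a vec"
  have sn: "2 * s \<le> n" using c cn by auto
  have "det (R_wit n s :: 'a mat) * det (R_inv_wit n s) = det (R_wit n s * R_inv_wit n s)"
    by (rule det_mult[symmetric, OF R_wit_carrier R_inv_wit_carrier])
  also have "\<dots> = 1" by (simp add: R_wit_inverse[OF sn])
  finally have "det (R_wit n s :: 'a mat) \<noteq> 0" by auto
  then have "det (R_of (n + s) ?x) \<noteq> 0" by (auto simp: R_of_point_of)
  then show ?thesis
    using kl by (intro basic_generic_commutator_comb[where ?x0.0 = ?x and c = c])
      (auto simp: P_wit_commutator_comb[OF kl cn c refl])
qed

text \<open>Invertibility is also claimed when neither bound on \<open>r\<close> holds, so it gets
  its own polynomial det R, nonzero at the identity.\<close>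

lemma basic_generic_invertible:
  "basic_generic (r ^ 2 + p * r) (\<lambda>x :: 'a::field vec. invertible_mat (R_of r x))"
proof -
  have "invertible_mat (R_of r x)" if "det (R_of r x) \<noteq> 0" for x :: "'a vec"
  proof -
    obtain B where B: "B \<in> carrier_mat r r" "R_of r x * B = 1\<^sub>m r" "B * R_of r x = 1\<^sub>m r"
      using inverse_if_det_nonzero[OF R_of_carrier \<open>det (R_of r x) \<noteq> 0\<close>] by metis
    then show ?thesis
      unfolding invertible_mat_def inverts_mat_def square_mat.simps
      using carrier_matD[OF R_of_carrier[of r x]] by (intro conjI exI[of _ B]) auto
  qed
  moreover have "det (R_of r (point_of r p (1\<^sub>m r) (\<lambda>_ _. 0))) \<noteq> (0 :: 'a)"
    by (simp add: R_of_point_of)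
  ultimately show ?thesis
    unfolding basic_generic_def
    by (intro exI[of _ "\<lambda>x. det (R_of r x)"] conjI polyfun_det[OF polyfun_mat_R_of]
        bexI[of _ "point_of r p (1\<^sub>m r) (\<lambda>_ _. 0)"]) auto
qed

lemma basic_generic_mono:
  assumes "basic_generic N P" "\<And>x. P x \<Longrightarrow> Q x"
  shows "basic_generic N Q"
  using assms unfolding basic_generic_def by blast

theorem theorem6:
  fixes n r p :: nat
  assumes "infinite (UNIV :: 'a::field set)"
    and "n \<le> r"
    and "p \<ge> 2"
  shows "generic (r ^ 2 + p * r) (\<lambda>x :: 'a vec.
      invertible_mat (R_of r x) \<and>
      (p \<ge> 2 \<and> real r \<le> 3 * real n / 2 \<longrightarrow>
        (\<forall>k < p. \<forall>l < p. k \<noteq> l \<longrightarrow>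
          subspace_dim n (Im_mat n (commutator (A_of n r x k) (A_of n r x l))) = 2 * (r - n))) \<and>
      (p \<ge> 3 \<and> real r \<le> 4 * real n / 3 \<longrightarrow>
        (\<forall>k < p. \<forall>l < p. \<forall>m < p. k \<noteq> l \<and> k \<noteq> m \<and> l \<noteq> m \<longrightarrow>
          subspace_dim n
            (subspace_sum n
              (Im_mat n (commutator (A_of n r x k) (A_of n r x l)))
              (Im_mat n (commutator (A_of n r x k) (A_of n r x m)))) = 3 * (r - n))))"
proof -
  obtain s where r: "r = n + s" using \<open>n \<le> r\<close> le_Suc_ex by blast
  let ?N = "r ^ 2 + p * r"
  let ?I = "\<lambda>(x :: 'a vec) k l. Im_mat n (commutator (A_of n r x k) (A_of n r x l))"
  \<comment> \<open>The bounds on \<open>s\<close> are part of the index sets, which are empty when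
    the corresponding bound on \<open>r\<close> fails.\<close>
  let ?T1 = "{(k, l). k < p \<and> l < p \<and> k \<noteq> l \<and> 2 * s \<le> n}"
  let ?T2 = "{(k, l, m). k < p \<and> l < p \<and> m < p \<and> k \<noteq> l \<and> k \<noteq> m \<and> l \<noteq> m \<and> 3 * s \<le> n}"
  have "?T1 \<subseteq> {..<p} \<times> {..<p}" "?T2 \<subseteq> {..<p} \<times> {..<p} \<times> {..<p}" by auto
  then have fin: "finite ?T1" "finite ?T2"
    by (auto intro: finite_subset)
  have 1: "basic_generic ?N (\<lambda>x. \<forall>(k, l) \<in> ?T1. subspace_dim n (?I x k l) = 2 * s)"
  proof (rule basic_generic_ball[OF assms(1) fin(1)])
    fix t assume "t \<in> ?T1"
    then obtain k l where t: "t = (k, l)" and kl: "k \<noteq> l" "k < p" "l < p" "2 * s \<le> n" by auto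
    show "basic_generic ?N (\<lambda>x. case t of (k, l) \<Rightarrow> subspace_dim n (?I x k l) = 2 * s)"
      unfolding t r prod.case
      \<comment> \<open>The index \<open>l\<close> also takes the place of \<open>m\<close>, with
        \<open>c = 2 * s\<close>.\<close>
      by (rule basic_generic_mono[OF basic_generic_wit[OF kl(1,2,3,3,4), of s]])
        (auto intro!: dim_Im_commutator[OF _ P_wit_carrier Q1_wit_carrier Q2_wit_carrier])
  qed
  have 2: "basic_generic ?N (\<lambda>x. \<forall>(k, l, m) \<in> ?T2. subspace_dim n (subspace_sum n (?I x k l) (?I x k m)) = 3 * s)"
  proof (rule basic_generic_ball[OF assms(1) fin(2)])
    fix t assume "t \<in> ?T2"
    then obtain k l m where t: "t = (k, l, m)" and klm: "k \<noteq> l" "k < p" "l < p" "m < p" "3 * s \<le> n"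
      "k \<noteq> m" "l \<noteq> m" by auto
    show "basic_generic ?N (\<lambda>x. case t of (k, l, m) \<Rightarrow>
        subspace_dim n (subspace_sum n (?I x k l) (?I x k m)) = 3 * s)"
      unfolding t r prod.case
      by (rule basic_generic_mono[OF basic_generic_wit[OF klm(1-5), of s]])
        (use klm in \<open>auto intro!: dim_sum_Im_commutators[OF _ P_wit_carrier Q1_wit_carrier Q2_wit_carrier]\<close>)
  qed
  \<comment> \<open>As \<open>r = n + s\<close>, the bounds on \<open>r\<close> say that two,
    respectively three, blocks of \<open>s\<close> coordinates fit into \<open>n\<close>.\<close>
  have s1: "real r \<le> 3 * real n / 2 \<longleftrightarrow> 2 * s \<le> n" and s2: "real r \<le> 4 * real n / 3 \<longleftrightarrow> 3 * s \<le> n"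
    by (auto simp: r field_simps)
  show ?thesis
    by (rule generic_if_basic_generic, rule basic_generic_mono[OF basic_generic_conj[OF assms(1)
            basic_generic_invertible basic_generic_conj[OF assms(1) 1 2]]])
      (auto simp: s1 s2 r)
qed

end
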